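(* For every dimension $d\ge 1$ there exist constants $c_{d,1},c_{d,2}>0$, depending only on $d$, such that the following holds. Let $n$ points be sampled i.i.d. uniformly from $[0,1]^d$, and form a random graph on these points by connecting each point to each of its $c_{d,1}\log n$ nearest neighbors independently with probability $$p=\frac{c_{d,2}\log\log n}{\log n}.$$ Then, with probability tending to $1$ as $n\to\infty$, the resulting graph has a connected component of size $n-o(n)$.
   Context: Edges are undirected; "nearest neighbors" refers to Euclidean distance among the sampled points (excluding the point itself). *)

theory Defs
  imports "HOL-Probability.Probability" "HOL-Library.Landau_Symbols"
begin

(* The points are indexed by {..<n}; distances are Euclidean on real ^ 'd.  When the distances
   from x i to the other points are pairwise distinct (almost surely the case for uniform samples)
   and k < n, this set has exactly k elements; with ties it may have more. *)
definition nearest_neighbors :: "nat \<Rightarrow> nat \<Rightarrow> (nat \<Rightarrow> real ^ 'd) \<Rightarrow> nat \<Rightarrow> nat set" where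
  "nearest_neighbors n k x i =
     {j. j < n \<and> j \<noteq> i \<and>
         card {l. l < n \<and> l \<noteq> i \<and> dist (x i) (x l) < dist (x i) (x j)} < k}"

(* b (i, j) is the outcome of the trial in which point i tries to connect to point j; it only
   matters if j is one of the k nearest neighbors of i.  The edge relation is symmetric: i and j
   are joined if either of the two trials is relevant and succeeds. *)
definition knn_edges ::
  "nat \<Rightarrow> nat \<Rightarrow> (nat \<Rightarrow> real ^ 'd) \<Rightarrow> (nat \<times> nat \<Rightarrow> bool) \<Rightarrow> (nat \<times> nat) set" where
  "knn_edges n k x b =
     {(i, j). i < n \<and> j < n \<and>
        ((j \<in> nearest_neighbors n k x i \<and> b (i, j)) \<or>
         (i \<in> nearest_neighbors n k x j \<and> b (j, i)))}"

definition connected_components :: "'a set \<Rightarrow> ('a \<times> 'a) set \<Rightarrow> 'a set set" where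
  "connected_components V E = V // {(u, v). u \<in> V \<and> v \<in> V \<and> (u, v) \<in> E\<^sup>*}"

(* n independent uniform points in the unit cube ('1' is the all-ones vector) together with an
   independent family of Bernoulli trials with success probability p, one for each ordered pair. *)
definition knn_space ::
  "nat \<Rightarrow> real \<Rightarrow> ((nat \<Rightarrow> real ^ 'd) \<times> (nat \<times> nat \<Rightarrow> bool)) measure" where
  "knn_space n p =
     (\<Pi>\<^sub>M i\<in>{..<n}. uniform_measure lborel (cbox 0 1)) \<Otimes>\<^sub>M
     (\<Pi>\<^sub>M e\<in>{..<n} \<times> {..<n}. measure_pmf (bernoulli_pmf p))"

(* Natural logarithms; the number of neighbors is rounded down to an integer. *)
definition num_neighbors :: "real \<Rightarrow> nat \<Rightarrow> nat" where
  "num_neighbors c n = nat \<lfloor>c * ln (real n)\<rfloor>"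

(* This need not lie in [0, 1] for small n, where bernoulli_pmf truncates it to [0, 1]; it does
   for all sufficiently large n. *)
definition edge_prob :: "real \<Rightarrow> nat \<Rightarrow> real" where
  "edge_prob c n = c * ln (ln (real n)) / ln (real n)"

end

theory Submission
  imports Defs "HOL-Real_Asymp.Real_Asymp"
begin

text \<open>
  Cut the cube into \<open>m\<^sup>d\<close> cells with \<open>m\<^sup>d\<close> about \<open>n / (8 ln n)\<close>. By Chernoff bounds for the cell
  counts, with high probability every cell contains at least \<open>ln n\<close> points, while the neighborhood
  of each cell contains at most \<open>b ln n\<close> points. For \<open>c\<^sub>1 > b\<close> all pairs of points in the union of
  two touching cells are then candidate edges.

  Given such points, any two disjoint sets of at least \<open>s \<approx> ln n / (ln ln n)\<^bsup>1/4\<^esup>\<close> points in the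
  same union are joined by an edge, except with probability
  \<open>n \<sqdot> exp (2 b ln n - p s\<^sup>2) = o(1)\<close>, because \<open>p s\<^sup>2\<close> is of order \<open>ln n \<sqdot> (ln ln n)\<^bsup>1/2\<^esup>\<close>. Hence
  one component contains all but fewer than \<open>s\<close> points of each union. Touching cells share
  it, since their unions overlap in a full cell, and walking diagonally towards the origin
  connects every cell to the first one. So one component misses at most \<open>m\<^sup>d s = o(n)\<close> points.
\<close>

section \<open>Gluing locally dominant components\<close>

text \<open>
  Among the unions of components within \<open>U\<close> that have at least \<open>s\<close> points, one of minimal size
  is a single component: two proper parts would have fewer than \<open>s\<close> points each, and so would the
  complement.
\<close>
lemma dominant_class:
  assumes fin: "finite U" and sy: "sym E" and size: "3 * s \<le> card U"
    and joined: "\<And>A B. A \<subseteq> U \<Longrightarrow> B \<subseteq> U \<Longrightarrow> A \<inter> B = {} \<Longrightarrow> s \<le> card A \<Longrightarrow> s \<le> card B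
                   \<Longrightarrow> \<exists>a\<in>A. \<exists>b\<in>B. (a, b) \<in> E"
  shows "\<exists>u\<in>U. card (U - E\<^sup>* `` {u}) < s"
proof -
  \<comment> \<open>Closed sets are unions of traces on \<open>U\<close> of components of the whole
    graph: the connecting paths may leave \<open>U\<close>, since \<open>E\<^sup>*\<close> is not
    restricted to it.\<close>
  define closed where "closed T \<longleftrightarrow> T \<subseteq> U \<and> (\<forall>x\<in>T. \<forall>y\<in>U. (x, y) \<in> E\<^sup>* \<longrightarrow> y \<in> T)" for T
  have syr: "sym (E\<^sup>*)"
    using sy by (rule sym_rtrancl)
  have compl: "card (U - T) < s" if T: "closed T" "s \<le> card T" for T
  proof (rule ccontr)
    assume "\<not> card (U - T) < s"
    then obtain a b where "a \<in> T" "b \<in> U - T" "(a, b) \<in> E"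
      using joined[of T "U - T"] T unfolding closed_def by (metis Diff_disjoint Diff_subset leI)
    then show False
      using T by (auto simp: closed_def)
  qed
  have "closed U \<and> s \<le> card U"
    using size by (auto simp: closed_def)
  then obtain T where T: "closed T" "s \<le> card T"
    and minimal: "\<And>T'. closed T' \<Longrightarrow> s \<le> card T' \<Longrightarrow> card T \<le> card T'"
    using ex_has_least_nat[of "\<lambda>T. closed T \<and> s \<le> card T" U card] by blast
  \<comment> \<open>For \<open>s = 0\<close> two empty sets would have to be joined by an edge.
    Positivity makes \<open>T\<close> nonempty.\<close>
  have "s > 0"
    using joined[of "{}" "{}"] by auto
  then obtain u where u: "u \<in> T"
    using T by fastforce
  have "T \<subseteq> U" "finite T"
    using T(1) fin finite_subset by (auto simp: closed_def)
  define K where "K = U \<inter> E\<^sup>* `` {u}"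
  have K: "closed K" "u \<in> K" "K \<subseteq> T"
    using u T(1) by (auto simp: closed_def K_def)
  \<comment> \<open>By symmetry no path leads from outside a class into it, so removing a class from
    a union of classes leaves such a union.\<close>
  have rest: "closed (T - K)"
    using T(1) K(3) syr by (auto simp: closed_def K_def sym_def intro: rtrancl_trans)
  have "K = T"
  proof (rule ccontr)
    assume "K \<noteq> T"
    then have "card K < card T" "card (T - K) < card T"
      using K \<open>finite T\<close> by (auto intro!: psubset_card_mono)
    then have "card K < s" "card (T - K) < s"
      using minimal K(1) rest by (meson leD leI)+
    moreover have "card T = card K + card (T - K)"
      using K \<open>finite T\<close> by (metis card_Diff_subset card_mono finite_subset le_add_diff_inverse)
    moreover have "card U = card T + card (U - T)"
      using \<open>T \<subseteq> U\<close> fin by (metis card_Diff_subset card_mono finite_subset le_add_diff_inverse)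
    ultimately show False
      using compl[OF T] size by linarith
  qed
  then have "U - E\<^sup>* `` {u} = U - T"
    by (auto simp: K_def)
  then show ?thesis
    using compl[OF T] u \<open>T \<subseteq> U\<close> by (intro bexI[of _ u]) auto
qed

text \<open>Each union \<open>Q z \<union> Q (parent z)\<close> has a dominant class by
  \<open>dominant_class\<close>. The unions of \<open>z\<close> and of \<open>parent z\<close> share
  \<open>Q (parent z)\<close>, which is too large to be missed by both classes together, so the two
  classes coincide. Following \<open>parent\<close> down to the root identifies all of them, and the
  common class loses fewer than \<open>s\<close> points per index.\<close>

lemma giant_component:
  fixes parent :: "'z \<Rightarrow> 'z" and rank :: "'z \<Rightarrow> nat" and V :: "'v set"
  assumes fin: "finite V" "finite Z" and sy: "sym E"
    and root: "z0 \<in> Z"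
    and parent: "\<And>z. z \<in> Z \<Longrightarrow> parent z \<in> Z"
    and rank: "\<And>z. z \<in> Z \<Longrightarrow> z \<noteq> z0 \<Longrightarrow> rank (parent z) < rank z"
    and cover: "V = (\<Union>z\<in>Z. Q z)"
    and size: "\<And>z. z \<in> Z \<Longrightarrow> 3 * s \<le> card (Q z)"
    and joined: "\<And>z A B. z \<in> Z \<Longrightarrow> A \<subseteq> Q z \<union> Q (parent z) \<Longrightarrow> B \<subseteq> Q z \<union> Q (parent z) \<Longrightarrow>
                   A \<inter> B = {} \<Longrightarrow> s \<le> card A \<Longrightarrow> s \<le> card B \<Longrightarrow> \<exists>a\<in>A. \<exists>b\<in>B. (a, b) \<in> E"
  shows "\<exists>C\<in>connected_components V E. card V \<le> card C + card Z * s"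
proof -
  define U where "U z = Q z \<union> Q (parent z)" for z
  have finQ: "finite (Q z)" and QV: "Q z \<subseteq> V" if "z \<in> Z" for z
    using that cover fin by (auto intro: finite_subset)
  have finU: "finite (U z)" and UV: "U z \<subseteq> V" if "z \<in> Z" for z
    using that finQ QV parent by (auto simp: U_def)
  have "\<exists>u\<in>U z. card (U z - E\<^sup>* `` {u}) < s" if z: "z \<in> Z" for z
  proof (rule dominant_class[OF finU[OF z] sy])
    show "3 * s \<le> card (U z)"
      using size[OF z] card_mono[OF finU[OF z], of "Q z"] by (auto simp: U_def)
  qed (use joined[OF z] in \<open>auto simp: U_def\<close>)
  then obtain c where c: "\<And>z. z \<in> Z \<Longrightarrow> c z \<in> U z"
    and miss: "\<And>z. z \<in> Z \<Longrightarrow> card (U z - E\<^sup>* `` {c z}) < s"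
    by metis
  have syr: "sym (E\<^sup>*)"
    using sy by (rule sym_rtrancl)
  have class_eq: "E\<^sup>* `` {u} = E\<^sup>* `` {v}" if "(u, v) \<in> E\<^sup>*" for u v
    using that syr by (auto simp: sym_def intro: rtrancl_trans)
  have step: "(c (parent z), c z) \<in> E\<^sup>*" if z: "z \<in> Z" for z
  proof -
    note pz = parent[OF z]
    have "Q (parent z) - E\<^sup>* `` {c w} \<subseteq> U w - E\<^sup>* `` {c w}" if "w = z \<or> w = parent z" for w
      using that by (auto simp: U_def)
    then have few: "card (Q (parent z) - E\<^sup>* `` {c w}) < s" if "w = z \<or> w = parent z" for w
      using that miss finU z pz
      by (metis (no_types, lifting) card_mono finite_Diff le_less_trans)
    \<comment> \<open>Two exceptional sets of fewer than \<open>s\<close> points each cannot exhaust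
      at least \<open>3 * s\<close> points. A point outside both lies in both classes.\<close>
    have "card (Q (parent z)) > card ((Q (parent z) - E\<^sup>* `` {c z}) \<union> (Q (parent z) - E\<^sup>* `` {c (parent z)}))"
      using few[OF disjI1[OF refl]] few[OF disjI2[OF refl]] size[OF pz]
        card_Un_le[of "Q (parent z) - E\<^sup>* `` {c z}" "Q (parent z) - E\<^sup>* `` {c (parent z)}"]
      by linarith
    then have "Q (parent z) \<noteq> (Q (parent z) - E\<^sup>* `` {c z}) \<union> (Q (parent z) - E\<^sup>* `` {c (parent z)})"
      by (metis less_irrefl)
    then obtain q where "(c z, q) \<in> E\<^sup>*" "(c (parent z), q) \<in> E\<^sup>*"
      by blast
    then show ?thesis
      using syr by (meson rtrancl_trans symD)
  qed
  have all: "z \<in> Z \<Longrightarrow> (c z0, c z) \<in> E\<^sup>*" for z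
  proof (induction "rank z" arbitrary: z rule: less_induct)
    case less
    then show ?case
      by (cases "z = z0") (auto intro: rtrancl_trans[OF _ step] simp: parent rank)
  qed
  define C where "C = V \<inter> E\<^sup>* `` {c z0}"
  have "c z0 \<in> V"
    using c UV root by blast
  then have "C \<in> connected_components V E"
    by (auto simp: connected_components_def quotient_def C_def intro!: bexI[of _ "c z0"])
  moreover have "card V \<le> card C + card Z * s"
  proof -
    have "V - C \<subseteq> (\<Union>z\<in>Z. U z - E\<^sup>* `` {c z})"
      using class_eq[OF all] cover by (auto simp: C_def U_def)
    then have "card (V - C) \<le> card (\<Union>z\<in>Z. U z - E\<^sup>* `` {c z})"
      using fin finU by (intro card_mono) auto
    also have "\<dots> \<le> (\<Sum>z\<in>Z. card (U z - E\<^sup>* `` {c z}))"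
      using fin by (intro card_UN_le)
    also have "\<dots> \<le> (\<Sum>z\<in>Z. s)"
      using miss by (intro sum_mono) (simp add: less_imp_le)
    finally have "card (V - C) \<le> card Z * s"
      by simp
    moreover have "card V = card C + card (V - C)"
      using fin by (metis C_def card_Diff_subset card_mono finite_Int inf_le1 le_add_diff_inverse)
    ultimately show ?thesis
      by simp
  qed
  ultimately show ?thesis
    by blast
qed

section \<open>Cells\<close>

definition pts :: "nat \<Rightarrow> (nat \<Rightarrow> 'a) \<Rightarrow> 'a set \<Rightarrow> nat set" where
  "pts n x A = {i. i < n \<and> x i \<in> A}"

definition grid :: "nat \<Rightarrow> ('d::finite \<Rightarrow> nat) set" where
  "grid m = {z. \<forall>i. z i < m}"

text \<open>Closed boxes: neighboring cells share faces, and the faces of the cube are covered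
  too.\<close>

definition cell :: "nat \<Rightarrow> ('d::finite \<Rightarrow> nat) \<Rightarrow> (real ^ 'd) set" where
  "cell m z = cbox (\<chi> i. real (z i) / real m) (\<chi> i. (real (z i) + 1) / real m)"

text \<open>
  The half-width \<open>(2 d + 1) / m\<close> makes this box contain every ball around a point of the cell, or of
  its predecessor, that reaches no further than another such point (see \<open>ball_subset_block\<close>).
\<close>
definition block :: "nat \<Rightarrow> ('d::finite \<Rightarrow> nat) \<Rightarrow> (real ^ 'd) set" where
  "block m z = cbox (\<chi> i. (real (z i) - (2 * CARD('d) + 1)) / real m)
                    (\<chi> i. (real (z i) + (2 * CARD('d) + 1)) / real m)"

text \<open>
  Truncated subtraction is intended: iterating this diagonal step ends in the cell \<open>0\<close>.
\<close>
definition pred_cell :: "('d::finite \<Rightarrow> nat) \<Rightarrow> 'd \<Rightarrow> nat" where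
  "pred_cell z = (\<lambda>i. z i - 1)"

lemma finite_pts [simp]: "finite (pts n x A)"
  by (simp add: pts_def)

lemma grid_eq: "grid m = UNIV \<rightarrow>\<^sub>E {..<m}"
  by (auto simp: grid_def PiE_def extensional_def)

lemma finite_grid: "finite (grid m)"
  by (simp add: grid_eq finite_PiE)

lemma card_grid: "card (grid m :: ('d::finite \<Rightarrow> nat) set) = m ^ CARD('d)"
  by (simp add: grid_eq card_funcsetE)

lemma pred_cell_grid: "z \<in> grid m \<Longrightarrow> pred_cell z \<in> grid m"
  by (auto simp: grid_def pred_cell_def intro: le_less_trans[OF diff_le_self])

lemma unit_cube_cells:
  fixes y :: "real ^ 'd"
  assumes "m > 0" and y: "y \<in> cbox 0 1"
  shows "\<exists>z\<in>grid m. y \<in> cell m z"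
proof -
  \<comment> \<open>The minimum puts points with a coordinate equal to 1 into the last cell.\<close>
  define z where "z i = min (nat \<lfloor>m * y $ i\<rfloor>) (m - 1)" for i
  have "z \<in> grid m"
    using \<open>m > 0\<close> by (auto simp: grid_def z_def)
  moreover have "real (z i) / m \<le> y $ i \<and> y $ i \<le> (real (z i) + 1) / m" for i
  proof -
    have yi: "0 \<le> y $ i" "y $ i \<le> 1"
      using y by (auto simp: mem_box_cart)
    have fl: "real (nat \<lfloor>m * y $ i\<rfloor>) \<le> m * y $ i" "m * y $ i < real (nat \<lfloor>m * y $ i\<rfloor>) + 1"
      using yi by (auto simp: of_nat_floor)
    have "real (z i) \<le> m * y $ i"
      using fl by (auto simp: z_def)
    moreover have "m * y $ i \<le> real (z i) + 1"
    proof (cases "nat \<lfloor>m * y $ i\<rfloor> \<le> m - 1")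
      case True
      then show ?thesis using fl by (simp add: z_def)
    next
      case False
      then have "real (z i) + 1 = m" using \<open>m > 0\<close> by (simp add: z_def)
      then show ?thesis using yi by (simp add: mult_left_le)
    qed
    ultimately show ?thesis
      using \<open>m > 0\<close> by (simp add: field_simps)
  qed
  ultimately show ?thesis
    by (auto simp: cell_def mem_box_cart)
qed

lemma near_cells:
  fixes y :: "real ^ 'd"
  assumes "m > 0" and y: "y \<in> cell m z \<union> cell m (pred_cell z)"
  shows "\<bar>y $ i - real (z i) / m\<bar> \<le> 1 / m"
proof -
  \<comment> \<open>Both bounds also hold for \<open>z i = 0\<close>, where the truncated difference
    stays 0 and the predecessor has the same coordinate.\<close>
  have "real (z i) - 1 \<le> real (z i - 1)" "real (z i - 1) \<le> real (z i)"
    by linarith+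
  moreover have "real (z i) \<le> m * y $ i \<and> m * y $ i \<le> real (z i) + 1 \<or>
        real (z i - 1) \<le> m * y $ i \<and> m * y $ i \<le> real (z i - 1) + 1"
    using y \<open>m > 0\<close> by (auto simp: cell_def mem_box_cart pred_cell_def field_simps)
  ultimately have "\<bar>m * y $ i - real (z i)\<bar> \<le> 1"
    by (smt (verit) of_nat_0_le_iff of_nat_diff of_nat_1 diff_is_0_eq' of_nat_0 nat_le_linear)
  moreover have "\<bar>y $ i - real (z i) / m\<bar> = \<bar>m * y $ i - real (z i)\<bar> / m"
    using \<open>m > 0\<close> by (simp add: field_simps abs_divide[symmetric] flip: abs_of_pos)
  ultimately show ?thesis
    using \<open>m > 0\<close> by (simp add: divide_right_mono)
qed

text \<open>By \<open>near_cells\<close>, \<open>y\<close> and \<open>y'\<close> differ by at most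
  \<open>2 / m\<close> in each coordinate, hence by at most \<open>2 * d / m\<close> in distance.
  The deviation of \<open>y\<close> from the lower corner of the cell adds another
  \<open>1 / m\<close>.\<close>

lemma ball_subset_block:
  fixes y :: "real ^ 'd"
  assumes "m > 0" and y: "y \<in> cell m z \<union> cell m (pred_cell z)"
    and y': "y' \<in> cell m z \<union> cell m (pred_cell z)"
    and w: "dist y w < dist y y'"
  shows "w \<in> block m z"
proof -
  have "dist y y' \<le> (\<Sum>i\<in>UNIV. \<bar>(y - y') $ i\<bar>)"
    unfolding dist_norm by (rule norm_le_l1_cart)
  also have "\<dots> \<le> (\<Sum>i\<in>(UNIV :: 'd set). 2 / m)"
  proof (rule sum_mono)
    fix i
    show "\<bar>(y - y') $ i\<bar> \<le> 2 / m"
      using near_cells[OF \<open>m > 0\<close> y, of i] near_cells[OF \<open>m > 0\<close> y', of i]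
      by (simp add: abs_le_iff field_simps)
  qed
  finally have "dist y y' \<le> 2 * CARD('d) / m"
    by (simp add: mult.commute)
  have "\<bar>w $ i - real (z i) / m\<bar> \<le> (2 * CARD('d) + 1) / m" for i
  proof -
    have "\<bar>(y - w) $ i\<bar> \<le> dist y w"
      unfolding dist_norm by (rule component_le_norm_cart)
    then show ?thesis
      using near_cells[OF \<open>m > 0\<close> y, of i] w \<open>dist y y' \<le> 2 * CARD('d) / m\<close>
      by (simp add: add_divide_distrib abs_le_iff)
  qed
  then show ?thesis
    by (auto simp: block_def mem_box_cart abs_le_iff add_divide_distrib diff_divide_distrib
          algebra_simps)
qed

lemma near_cells_subset_block:
  assumes "m > 0"
  shows "cell m z \<union> cell m (pred_cell z) \<subseteq> (block m z :: (real ^ 'd) set)"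
proof
  fix y :: "real ^ 'd" assume y: "y \<in> cell m z \<union> cell m (pred_cell z)"
  have "\<bar>y $ i - real (z i) / m\<bar> \<le> (2 * CARD('d) + 1) / m" for i
    using near_cells[OF assms y, of i] by (simp add: add_divide_distrib)  (smt (verit) divide_nonneg_nonneg of_nat_0_le_iff)
  then show "y \<in> block m z"
    by (auto simp: block_def mem_box_cart abs_le_iff add_divide_distrib diff_divide_distrib
          algebra_simps)
qed

section \<open>Nearest neighbors and a deterministic criterion for a giant component\<close>

text \<open>All points strictly closer to \<open>a\<close> than \<open>b\<close> is lie in the
  block, which holds fewer than \<open>k\<close> points. The count is of strictly closer points, so
  ties do no harm.\<close>

lemma near_cells_nearest_neighbors:
  fixes x :: "nat \<Rightarrow> real ^ 'd"
  assumes "m > 0" and few: "card (pts n x (block m z)) < k"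
    and a: "a \<in> pts n x (cell m z) \<union> pts n x (cell m (pred_cell z))"
    and b: "b \<in> pts n x (cell m z) \<union> pts n x (cell m (pred_cell z))"
    and "a \<noteq> b"
  shows "b \<in> nearest_neighbors n k x a"
proof -
  have "{l. l < n \<and> l \<noteq> a \<and> dist (x a) (x l) < dist (x a) (x b)} \<subseteq> pts n x (block m z)"
    using a b ball_subset_block[OF \<open>m > 0\<close>] by (auto simp: pts_def)
  then have "card {l. l < n \<and> l \<noteq> a \<and> dist (x a) (x l) < dist (x a) (x b)} < k"
    using few by (meson card_mono finite_pts le_less_trans)
  then show ?thesis
    using b \<open>a \<noteq> b\<close> by (auto simp: nearest_neighbors_def pts_def)
qed

text \<open>The deterministic half of the argument, for a fixed sample and fixed trial outcomes.
  Points of two touching cells are candidates for each other, so within them a successful trial is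
  an edge and \<open>giant_component\<close> applies.\<close>

lemma knn_giant_component:
  fixes x :: "nat \<Rightarrow> real ^ 'd"
  assumes "m > 0" and cube: "\<And>i. i < n \<Longrightarrow> x i \<in> cbox 0 1"
    and lower: "\<And>z. z \<in> grid m \<Longrightarrow> 3 * s \<le> card (pts n x (cell m z))"
    and upper: "\<And>z. z \<in> grid m \<Longrightarrow> card (pts n x (block m z)) < k"
    and trials: "\<And>z A B. z \<in> grid m \<Longrightarrow> A \<subseteq> pts n x (block m z) \<Longrightarrow> B \<subseteq> pts n x (block m z) \<Longrightarrow>
                   A \<inter> B = {} \<Longrightarrow> s \<le> card A \<Longrightarrow> s \<le> card B \<Longrightarrow> \<exists>a\<in>A. \<exists>a'\<in>B. b (a, a')"
  shows "\<exists>C\<in>connected_components {..<n} (knn_edges n k x b). n \<le> card C + m ^ CARD('d) * s"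
proof -
  have zero: "(\<lambda>_. 0) \<in> grid m"
    using \<open>m > 0\<close> by (simp add: grid_def)
  have "\<exists>C\<in>connected_components {..<n} (knn_edges n k x b).
          card {..<n} \<le> card C + card (grid m :: ('d \<Rightarrow> nat) set) * s"
  \<comment> \<open>The rank is the coordinate sum: away from the zero cell some coordinate is
    positive, and the diagonal step lowers it.\<close>
  proof (rule giant_component[where Q = "\<lambda>z. pts n x (cell m z)" and parent = pred_cell
        and rank = "\<lambda>z. sum z UNIV" and ?z0.0 = "\<lambda>_. 0"])
    show "{..<n} = (\<Union>z\<in>grid m. pts n x (cell m z))"
      using unit_cube_cells[OF \<open>m > 0\<close> cube] by (auto simp: pts_def)
    show "sym (knn_edges n k x b)"
      by (auto simp: sym_def knn_edges_def)
    show "sum (pred_cell z) UNIV < sum z UNIV" if "z \<noteq> (\<lambda>_. 0)" for z :: "'d \<Rightarrow> nat"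
    proof -
      obtain i where "z i > 0"
        using \<open>z \<noteq> (\<lambda>_. 0)\<close> by (auto simp: fun_eq_iff)
      then show ?thesis
        by (intro sum_strict_mono_ex1) (auto simp: pred_cell_def intro!: exI[of _ i])
    qed
    fix z :: "'d \<Rightarrow> nat" and A B
    assume z: "z \<in> grid m"
      and A: "A \<subseteq> pts n x (cell m z) \<union> pts n x (cell m (pred_cell z))"
      and B: "B \<subseteq> pts n x (cell m z) \<union> pts n x (cell m (pred_cell z))"
      and AB: "A \<inter> B = {}" "s \<le> card A" "s \<le> card B"
    have sub: "pts n x (cell m z) \<union> pts n x (cell m (pred_cell z)) \<subseteq> pts n x (block m z)"
      using near_cells_subset_block[OF \<open>m > 0\<close>, of z] by (auto simp: pts_def)
    obtain a a' where aa: "a \<in> A" "a' \<in> B" "b (a, a')"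
      using trials[OF z order_trans[OF A sub] order_trans[OF B sub] AB] by blast
    moreover have "a' \<in> nearest_neighbors n k x a"
      using aa A B AB by (intro near_cells_nearest_neighbors[OF \<open>m > 0\<close> upper[OF z]]) auto
    moreover have "a < n" "a' < n"
      using A B aa by (auto simp: pts_def)
    ultimately show "\<exists>a\<in>A. \<exists>b'\<in>B. (a, b') \<in> knn_edges n k x b"
      by (auto simp: knn_edges_def)
  qed (use assms in \<open>auto simp: pred_cell_grid finite_grid zero\<close>)
  then show ?thesis
    by (simp add: card_grid)
qed

section \<open>Cell counts of uniform points\<close>

lemma card_pts_measurable:
  assumes "A \<in> sets P"
  shows "(\<lambda>x. real (card (pts n x A))) \<in> borel_measurable (\<Pi>\<^sub>M i\<in>{..<n}. P)"
proof -
  have "{x \<in> space (\<Pi>\<^sub>M i\<in>{..<n}. P). i \<in> pts n x A} \<in> sets (\<Pi>\<^sub>M i\<in>{..<n}. P)" for i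
  proof (cases "i < n")
    case True
    then have "(\<lambda>x. x i) \<in> (\<Pi>\<^sub>M i\<in>{..<n}. P) \<rightarrow>\<^sub>M P"
      by (intro measurable_component_singleton) auto
    from measurable_sets[OF this assms] True show ?thesis
      by (simp add: pts_def vimage_def Int_def conj_commute)
  qed (simp add: pts_def)
  then show ?thesis
    by measurable
qed

lemma integrable_exp_card_pts:
  fixes t :: real
  assumes P: "prob_space P" and A: "A \<in> sets P"
  shows "integrable (\<Pi>\<^sub>M i\<in>{..<n}. P) (\<lambda>x. exp (t * card (pts n x A)))"
proof -
  interpret prob_space "\<Pi>\<^sub>M i\<in>{..<n}. P"
    using P by (intro prob_space_PiM)
  note [measurable] = card_pts_measurable[OF A]
  have "card (pts n x A) \<le> card {..<n}" for x
    by (intro card_mono) (auto simp: pts_def)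
  then have le: "card (pts n x A) \<le> n" for x
    by simp
  have "t * card (pts n x A) \<le> \<bar>t\<bar> * n" for x
    using le[of x] by (intro mult_mono) auto
  then show ?thesis
    by (intro integrable_const_bound[where B = "exp (\<bar>t\<bar> * n)"]) auto
qed

text \<open>The moment generating function of a binomial variable. The exponential is a product of
  one factor per point, and independence turns the integral into a product of integrals.\<close>

lemma integral_exp_card_pts:
  fixes t :: real
  assumes P: "prob_space P" and A: "A \<in> sets P"
  shows "(\<integral>x. exp (t * card (pts n x A)) \<partial>(\<Pi>\<^sub>M i\<in>{..<n}. P)) = (1 + (exp t - 1) * measure P A) ^ n"
proof -
  interpret P: prob_space P by (rule P)
  interpret product_sigma_finite "\<lambda>_. P" by standard
  have "exp (t * card (pts n x A)) = (\<Prod>i<n. 1 + (exp t - 1) * indicator A (x i))" for x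
  proof -
    have "exp (t * card (pts n x A)) = (\<Prod>i\<in>pts n x A. exp t)"
      by (simp add: exp_of_nat2_mult)
    also have "\<dots> = (\<Prod>i\<in>pts n x A. 1 + (exp t - 1) * indicator A (x i))"
      by (intro prod.cong) (auto simp: pts_def)
    also have "\<dots> = (\<Prod>i<n. 1 + (exp t - 1) * indicator A (x i))"
      by (intro prod.mono_neutral_left) (auto simp: pts_def)
    finally show ?thesis .
  qed
  then have "(\<integral>x. exp (t * card (pts n x A)) \<partial>(\<Pi>\<^sub>M i\<in>{..<n}. P)) =
      (\<Prod>i<n. \<integral>y. 1 + (exp t - 1) * indicator A y \<partial>P)"
    using A product_integral_prod[of "{..<n}" "\<lambda>_ y. 1 + (exp t - 1) * indicator A y"]
    by (simp add: P.emeasure_eq_measure)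
  then show ?thesis
    using A by (simp add: P.emeasure_eq_measure P.prob_space)
qed

text \<open>Translates the set integrability demanded by the Chernoff inequalities.\<close>

lemma set_integrable_space: "set_integrable M (space M) f \<longleftrightarrow> integrable M f"
  unfolding set_integrable_def by (intro Bochner_Integration.integrable_cong) auto

lemma power_le_exp:
  fixes y :: real
  assumes "-1 \<le> y"
  shows "(1 + y) ^ n \<le> exp (n * y)"
proof -
  have "(1 + y) ^ n \<le> exp y ^ n"
    using assms by (intro power_mono) auto
  then show ?thesis
    by (simp add: exp_of_nat_mult)
qed

text \<open>Chernoff bound with exponent parameter 1. The factor 1/2 comes from
  \<open>1 - exp (-1) \<ge> 1/2\<close>.\<close>

lemma prob_few_pts:
  assumes P: "prob_space P" and A: "A \<in> sets P"
  shows "measure (\<Pi>\<^sub>M i\<in>{..<n}. P) {x \<in> space (\<Pi>\<^sub>M i\<in>{..<n}. P). card (pts n x A) \<le> (a::real)}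
           \<le> exp (a - n * measure P A / 2)"
proof -
  interpret P: prob_space P by (rule P)
  interpret prob_space "\<Pi>\<^sub>M i\<in>{..<n}. P"
    using P by (intro prob_space_PiM)
  have e: "exp (-1) \<le> (1/2 :: real)"
    using exp_ge_add_one_self[of 1] by (simp add: exp_minus field_simps)
  have "prob {x \<in> space (\<Pi>\<^sub>M i\<in>{..<n}. P). card (pts n x A) \<le> a}
          \<le> exp a * (1 + (exp (-1) - 1) * measure P A) ^ n"
    using Chernoff_ineq_le[of 1 "space (\<Pi>\<^sub>M i\<in>{..<n}. P)" "\<lambda>x. card (pts n x A)" a]
      integrable_exp_card_pts[OF P A, where t = "-1" and n = n] integral_exp_card_pts[OF P A, where t = "-1" and n = n]
    by (simp add: set_integral_space set_integrable_space)
  also have "(1 + (exp (-1) - 1) * measure P A) ^ n \<le> exp (n * ((exp (-1) - 1) * measure P A))"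
  proof (rule power_le_exp)
    have "(1 - exp (-1)) * measure P A \<le> 1 * 1"
      using P.prob_le_1 by (intro mult_mono) auto
    then show "- 1 \<le> (exp (-1) - 1) * measure P A"
      by (simp add: algebra_simps)
  qed
  also have "n * ((exp (-1) - 1) * measure P A) \<le> n * ((- 1/2) * measure P A)"
    using e by (intro mult_left_mono mult_right_mono) auto
  finally show ?thesis
    by (simp add: mult_exp_exp mult_left_mono)
qed

text \<open>Chernoff bound with exponent parameter 1. The factor 2 comes from
  \<open>exp 1 - 1 \<le> 2\<close>.\<close>

lemma prob_many_pts:
  assumes P: "prob_space P" and A: "A \<in> sets P"
  shows "measure (\<Pi>\<^sub>M i\<in>{..<n}. P) {x \<in> space (\<Pi>\<^sub>M i\<in>{..<n}. P). card (pts n x A) \<ge> (a::real)}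
           \<le> exp (2 * real n * measure P A - a)"
proof -
  interpret P: prob_space P by (rule P)
  interpret prob_space "\<Pi>\<^sub>M i\<in>{..<n}. P"
    using P by (intro prob_space_PiM)
  have "prob {x \<in> space (\<Pi>\<^sub>M i\<in>{..<n}. P). card (pts n x A) \<ge> a}
          \<le> exp (-a) * (1 + (exp 1 - 1) * measure P A) ^ n"
    using Chernoff_ineq_ge[of 1 "space (\<Pi>\<^sub>M i\<in>{..<n}. P)" "\<lambda>x. card (pts n x A)" a]
      integrable_exp_card_pts[OF P A, where t = 1 and n = n] integral_exp_card_pts[OF P A, where t = 1 and n = n]
    by (simp add: set_integral_space set_integrable_space)
  also have "(1 + (exp 1 - 1) * measure P A) ^ n \<le> exp (n * ((exp 1 - 1) * measure P A))"
  proof (rule power_le_exp)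
    have "0 \<le> (exp 1 - 1) * measure P A"
      by simp
    then show "- 1 \<le> (exp 1 - 1) * measure P A"
      by linarith
  qed
  also have "n * ((exp 1 - 1) * measure P A) \<le> n * (2 * measure P A)"
    using exp_le by (intro mult_left_mono mult_right_mono) auto
  finally show ?thesis
    by (simp add: mult_exp_exp mult_left_mono algebra_simps)
qed

section \<open>The uniform distribution on the cube and typical samples\<close>

abbreviation uniform_cube :: "(real ^ 'd) measure" where
  "uniform_cube \<equiv> uniform_measure lborel (cbox 0 1)"

lemma emeasure_unit_cube: "emeasure lborel (cbox 0 1 :: (real ^ 'd) set) = 1"
proof -
  have "(0 :: real ^ 'd) \<in> cbox 0 1"
    by (auto simp: mem_box_cart)
  then have "measure lborel (cbox 0 1 :: (real ^ 'd) set) = 1"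
    by (subst content_cbox_cart) auto
  then show ?thesis
    by (metis emeasure_eq_ennreal_measure emeasure_lborel_cbox_finite ennreal_1 infinity_ennreal_def less_irrefl)
qed

lemma prob_space_uniform_cube: "prob_space uniform_cube"
  by (intro prob_space_uniform_measure) (simp_all add: emeasure_unit_cube)

lemma measure_uniform_cube:
  assumes "A \<in> sets borel"
  shows "measure uniform_cube A = measure lborel (cbox 0 1 \<inter> A)"
  using assms by (simp add: measure_def emeasure_unit_cube divide_ennreal_def)

lemma cell_subset_cube:
  assumes "m > 0" "z \<in> grid m"
  shows "cell m z \<subseteq> cbox 0 1"
proof
  fix y assume y: "y \<in> cell m z"
  have "0 \<le> y $ i \<and> y $ i \<le> 1" for i
  proof -
    have "real (z i) + 1 \<le> m"
      using assms(2) by (metis (mono_tags, lifting) Suc_eq_plus1 Suc_leI grid_def mem_Collect_eq of_nat_1 of_nat_add of_nat_le_iff)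
    then have "0 \<le> real (z i) / m" "(real (z i) + 1) / m \<le> 1"
      using \<open>m > 0\<close> by auto
    then show ?thesis
      using y unfolding cell_def mem_box_cart vec_lambda_beta by (meson order_trans)
  qed
  then show "y \<in> cbox 0 1"
    by (auto simp: mem_box_cart)
qed

lemma measure_cell:
  assumes "m > 0" "z \<in> grid m"
  shows "measure uniform_cube (cell m z :: (real ^ 'd) set) = 1 / real m ^ CARD('d)"
proof -
  have "(\<chi> i. real (z i) / m) \<in> (cell m z :: (real ^ 'd) set)"
    by (auto simp: cell_def mem_box_cart divide_right_mono)
  then have "cell m z \<noteq> {}"
    by blast
  then have "measure lborel (cell m z :: (real ^ 'd) set) = (1 / m) ^ CARD('d)"
    unfolding cell_def by (subst content_cbox_cart) (auto simp flip: diff_divide_distrib)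
  then show ?thesis
    using cell_subset_cube[OF assms]
    by (simp add: measure_uniform_cube cell_def Int_absorb1 power_one_over)
qed

text \<open>A block may stick out of the cube, so its volume gives only an upper bound.\<close>

lemma measure_block_le:
  assumes "m > 0"
  shows "measure uniform_cube (block m z :: (real ^ 'd) set)
           \<le> (4 * real CARD('d) + 2) ^ CARD('d) / real m ^ CARD('d)"
proof -
  have "(\<chi> i. real (z i) / m) \<in> (block m z :: (real ^ 'd) set)"
    by (auto simp: block_def mem_box_cart divide_right_mono)
  then have "block m z \<noteq> {}"
    by blast
  then have "measure lborel (block m z :: (real ^ 'd) set) = ((4 * real CARD('d) + 2) / m) ^ CARD('d)"
    unfolding block_def
    by (subst content_cbox_cart) (auto simp: add.commute simp flip: diff_divide_distrib)
  moreover have "measure lborel (cbox 0 1 \<inter> block m z) \<le> measure lborel (block m z :: (real ^ 'd) set)"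
    by (intro measure_mono_fmeasurable) (auto simp: block_def)
  ultimately show ?thesis
    by (simp add: measure_uniform_cube block_def power_divide)
qed

text \<open>Membership in the cube is demanded explicitly because the underlying space of
  \<open>uniform_cube\<close> is all of \<open>real ^ 'd\<close>; it holds almost surely.\<close>

definition typical_pts :: "nat \<Rightarrow> nat \<Rightarrow> real \<Rightarrow> real \<Rightarrow> (nat \<Rightarrow> real ^ 'd) set" where
  "typical_pts n m lo hi = {x \<in> space (\<Pi>\<^sub>M i\<in>{..<n}. uniform_cube).
     (\<forall>i<n. x i \<in> cbox 0 1) \<and>
     (\<forall>z\<in>grid m. lo < real (card (pts n x (cell m z))) \<and> real (card (pts n x (block m z))) < hi)}"

text \<open>Union bound over the \<open>m ^ d\<close> cells, with one Chernoff bound for a cell that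
  is too empty and one for a block that is too full.\<close>

lemma typical_pts_prob:
  assumes "m > 0"
  shows "typical_pts n m lo hi \<in> sets (\<Pi>\<^sub>M i\<in>{..<n}. uniform_cube :: (real ^ 'd) measure)" (is ?meas)
    and "measure (\<Pi>\<^sub>M i\<in>{..<n}. uniform_cube) (typical_pts n m lo hi :: (nat \<Rightarrow> real ^ 'd) set) \<ge>
           1 - real m ^ CARD('d) * (exp (lo - n / real m ^ CARD('d) / 2) +
             exp (2 * real n * ((4 * real CARD('d) + 2) ^ CARD('d) / real m ^ CARD('d)) - hi))" (is ?prob)
proof -
  let ?P = "uniform_cube :: (real ^ 'd) measure"
  let ?M = "\<Pi>\<^sub>M i\<in>{..<n}. ?P"
  note P = prob_space_uniform_cube
  interpret P: product_prob_space "\<lambda>_. ?P" "{..<n}"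
    by (intro product_prob_spaceI P)
  have sets [simp, intro]: "cell m z \<in> sets borel" "block m z \<in> sets borel"
    "cell m z \<in> sets ?P" "block m z \<in> sets ?P" for z :: "'d \<Rightarrow> nat"
    by (auto simp: cell_def block_def)
  note [measurable] = card_pts_measurable[OF sets(3)] card_pts_measurable[OF sets(4)]
  let ?few = "\<lambda>z. {x \<in> space ?M. card (pts n x (cell m z)) \<le> lo}"
  let ?many = "\<lambda>z. {x \<in> space ?M. card (pts n x (block m z)) \<ge> hi}"
  let ?cube = "{x \<in> space ?M. \<forall>i\<in>{..<n}. x i \<in> cbox 0 1}"
  have cube: "?cube \<in> sets ?M" "P.P.prob ?cube = 1"
  proof -
    show "?cube \<in> sets ?M"
      by (intro sets.sets_Collect_finite_All) (auto intro!: sets_Collect_single')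
    have "emeasure ?M ?cube = (\<Prod>i<n. emeasure ?P (cbox 0 1))"
      by (intro P.emeasure_PiM_Collect) auto
    also have "\<dots> = 1"
      by (simp add: emeasure_unit_cube)
    finally show "P.P.prob ?cube = 1"
      by (simp add: measure_def)
  qed
  have fm [measurable]: "?few z \<in> sets ?M" "?many z \<in> sets ?M" for z
    by measurable
  have eq: "typical_pts n m lo hi = ?cube - (\<Union>z\<in>grid m. ?few z \<union> ?many z)"
    by (auto simp: typical_pts_def not_le not_less)
  show ?meas
    unfolding eq using cube finite_grid[of m] by auto
  have "P.P.prob (\<Union>z\<in>grid m. ?few z \<union> ?many z) \<le> (\<Sum>z\<in>grid m. P.P.prob (?few z \<union> ?many z))"
    using finite_grid by (intro measure_UNION_le) auto
  also have "\<dots> \<le> (\<Sum>z\<in>(grid m :: ('d \<Rightarrow> nat) set). exp (lo - n / real m ^ CARD('d) / 2) +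
             exp (2 * real n * ((4 * real CARD('d) + 2) ^ CARD('d) / real m ^ CARD('d)) - hi))"
  proof (rule sum_mono)
    fix z :: "'d \<Rightarrow> nat" assume z: "z \<in> grid m"
    have "P.P.prob (?few z \<union> ?many z) \<le> P.P.prob (?few z) + P.P.prob (?many z)"
      by (intro measure_Un_le) auto
    also have "P.P.prob (?few z) \<le> exp (lo - n / real m ^ CARD('d) / 2)"
      using prob_few_pts[OF P sets(3), of n z lo] measure_cell[OF assms z] by simp
    also have "P.P.prob (?many z) \<le> exp (2 * real n * measure ?P (block m z) - hi)"
      by (rule prob_many_pts[OF P sets(4)])
    also have "\<dots> \<le> exp (2 * real n * ((4 * real CARD('d) + 2) ^ CARD('d) / real m ^ CARD('d)) - hi)"
      by (simp only: exp_le_cancel_iff)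
         (intro diff_right_mono mult_left_mono measure_block_le assms, simp)
    finally show "P.P.prob (?few z \<union> ?many z) \<le> exp (lo - n / real m ^ CARD('d) / 2) +
             exp (2 * real n * ((4 * real CARD('d) + 2) ^ CARD('d) / real m ^ CARD('d)) - hi)"
      by simp
  qed
  finally have "P.P.prob (\<Union>z\<in>grid m. ?few z \<union> ?many z) \<le>
      real m ^ CARD('d) * (exp (lo - n / real m ^ CARD('d) / 2) +
        exp (2 * real n * ((4 * real CARD('d) + 2) ^ CARD('d) / real m ^ CARD('d)) - hi))"
    by (simp add: card_grid)
  moreover have "P.P.prob (typical_pts n m lo hi) \<ge> P.P.prob ?cube - P.P.prob (\<Union>z\<in>grid m. ?few z \<union> ?many z)"
    unfolding eq using cube finite_grid[of m]
    by (subst P.P.finite_measure_Diff') (auto intro!: P.P.finite_measure_mono)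
  ultimately show ?prob
    using cube by simp
qed

section \<open>Bernoulli trials\<close>

abbreviation trials :: "'e set \<Rightarrow> real \<Rightarrow> ('e \<Rightarrow> bool) measure" where
  "trials V p \<equiv> \<Pi>\<^sub>M e\<in>V. measure_pmf (bernoulli_pmf p)"

lemma prob_trials_all_fail:
  assumes p: "0 \<le> p" "p \<le> 1" and E: "E \<subseteq> V" "finite E"
  shows "{b \<in> space (trials V p). \<forall>e\<in>E. \<not> b e}
           \<in> sets (trials V p)"
    and "measure (trials V p) {b \<in> space (trials V p). \<forall>e\<in>E. \<not> b e} = (1 - p) ^ card E"
proof -
  let ?B = "trials V p"
  let ?S = "{b \<in> space ?B. \<forall>e\<in>E. \<not> b e}"
  interpret B: product_prob_space "\<lambda>_. measure_pmf (bernoulli_pmf p)" V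
    by (intro product_prob_spaceI measure_pmf.prob_space_axioms)
  have S: "?S = {b \<in> space ?B. \<forall>e\<in>E. b e \<in> {False}}"
    by auto
  show "?S \<in> sets ?B"
    unfolding S using E by (intro sets.sets_Collect_finite_All) (auto intro!: sets_Collect_single')
  have "emeasure ?B ?S = (\<Prod>e\<in>E. emeasure (measure_pmf (bernoulli_pmf p)) {False})"
    unfolding S using E by (intro B.emeasure_PiM_Collect) auto
  also have "\<dots> = ennreal ((1 - p) ^ card E)"
    using p by (simp add: emeasure_pmf_single ennreal_power)
  finally show "measure ?B ?S = (1 - p) ^ card E"
    using p by (simp add: measure_def)
qed

text \<open>The failure, for one block, of the hypothesis \<open>trials\<close> of
  \<open>knn_giant_component\<close>. It speaks of all ordered pairs from \<open>A\<close> to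
  \<open>B\<close>, whether or not they are candidate edges, so for fixed \<open>U\<close> it
  depends on the trials alone.\<close>

definition unjoined :: "nat \<Rightarrow> nat set \<Rightarrow> (nat \<times> nat \<Rightarrow> bool) \<Rightarrow> bool" where
  "unjoined s U b \<longleftrightarrow> (\<exists>A\<subseteq>U. \<exists>B\<subseteq>U. A \<inter> B = {} \<and> s \<le> card A \<and> s \<le> card B \<and>
     (\<forall>e\<in>A \<times> B. \<not> b e))"

text \<open>Union bound over the pairs \<open>(A, B)\<close>: there are at most
  \<open>4 ^ card U \<le> exp (2 * hi)\<close> of them, and each involves at least
  \<open>s\<^sup>2\<close> independent trials that must all fail.\<close>

lemma prob_unjoined:
  assumes p: "0 \<le> p" "p \<le> 1" and U: "U \<subseteq> {..<n}" "card U \<le> (hi :: real)"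
  shows "{b \<in> space (trials ({..<n} \<times> {..<n}) p). unjoined s U b}
           \<in> sets (trials ({..<n} \<times> {..<n}) p)"
    and "measure (trials ({..<n} \<times> {..<n}) p)
             {b \<in> space (trials ({..<n} \<times> {..<n}) p). unjoined s U b}
           \<le> exp (2 * hi - p * (real s)\<^sup>2)"
proof -
  let ?B = "trials ({..<n} \<times> {..<n}) p"
  let ?S = "{b \<in> space ?B. unjoined s U b}"
  let ?F = "\<lambda>(A, B). {b \<in> space ?B. \<forall>e\<in>A \<times> B. \<not> b e}"
  define I where "I = {(A, B). A \<subseteq> U \<and> B \<subseteq> U \<and> A \<inter> B = {} \<and> s \<le> card A \<and> s \<le> card B}"
  have S: "?S = (\<Union>i\<in>I. ?F i)"
    by (auto simp: unjoined_def I_def)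
  have finU: "finite U"
    using U(1) finite_subset by auto
  have I: "I \<subseteq> Pow U \<times> Pow U"
    by (auto simp: I_def)
  then have finI: "finite I"
    using finU finite_subset by blast
  have sub: "A \<times> B \<subseteq> {..<n} \<times> {..<n}" "finite (A \<times> B)" if "(A, B) \<in> I" for A B
    using that U(1) finU by (auto simp: I_def intro: finite_subset)
  note F = prob_trials_all_fail[OF p sub]
  show "?S \<in> sets ?B"
    unfolding S using finI F(1) by (intro sets.finite_UN) auto
  have "measure ?B ?S \<le> (\<Sum>i\<in>I. measure ?B (?F i))"
    unfolding S using finI F(1) by (intro measure_UNION_le) auto
  also have "\<dots> \<le> (\<Sum>i\<in>I. exp (- (p * (real s)\<^sup>2)))"
  proof (rule sum_mono)
    fix i assume "i \<in> I"
    then obtain A B where i: "i = (A, B)" and AB: "(A, B) \<in> I"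
      by (cases i) auto
    have "s\<^sup>2 \<le> card (A \<times> B)"
      using AB by (auto simp: I_def card_cartesian_product power2_eq_square intro: mult_mono)
    have "(1 - p) ^ card (A \<times> B) \<le> exp (card (A \<times> B) * - p)"
      using power_le_exp[of "- p" "card (A \<times> B)"] p by simp
    also have "\<dots> \<le> exp (- (p * (real s)\<^sup>2))"
      using \<open>s\<^sup>2 \<le> card (A \<times> B)\<close> p
      by (simp del: card_cartesian_product add: mult.commute mult_left_mono flip: of_nat_power)
    finally show "measure ?B (?F i) \<le> exp (- (p * (real s)\<^sup>2))"
      using F(2)[OF AB AB] i by simp
  qed
  also have "\<dots> = card I * exp (- (p * (real s)\<^sup>2))"
    by simp
  also have "real (card I) \<le> exp (2 * hi)"
  proof -
    have "(2 :: real) ^ card U \<le> exp 1 ^ card U"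
      using exp_ge_add_one_self[of 1] by (intro power_mono) auto
    also have "\<dots> \<le> exp hi"
      using U(2) by (simp flip: exp_of_nat_mult)
    finally have pow2: "(2 :: real) ^ card U \<le> exp hi" .
    have "card I \<le> card (Pow U \<times> Pow U)"
      using finU by (intro card_mono I) auto
    also have "\<dots> = 2 ^ card U * 2 ^ card U"
      using finU by (simp add: card_Pow)
    finally have "real (card I) \<le> real (2 ^ card U * 2 ^ card U)"
      by (simp only: of_nat_le_iff)
    then have "real (card I) \<le> 2 ^ card U * 2 ^ card U"
      by simp
    also have "\<dots> \<le> exp hi * exp hi"
      using pow2 by (intro mult_mono) auto
    finally have "real (card I) \<le> exp hi * exp hi"
      by simp
    then show ?thesis
      by (simp add: mult_exp_exp)
  qed
  finally show "measure ?B ?S \<le> exp (2 * hi - p * (real s)\<^sup>2)"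
    by (simp add: exp_diff exp_minus divide_inverse)
qed

section \<open>Measurability of graph events and combination of points and trials\<close>

text \<open>The edge set is a random element of a finite set, so every property \<open>R\<close> of
  it is an event once each single edge is measurable.\<close>

lemma knn_edges_event:
  "{\<omega> \<in> space (knn_space n p :: ((nat \<Rightarrow> real ^ 'd) \<times> _) measure). R (knn_edges n k (fst \<omega>) (snd \<omega>))}
     \<in> sets (knn_space n p)"
proof -
  let ?K = "knn_space n p :: ((nat \<Rightarrow> real ^ 'd) \<times> (nat \<times> nat \<Rightarrow> bool)) measure"
  let ?g = "\<lambda>\<omega>. knn_edges n k (fst \<omega> :: nat \<Rightarrow> real ^ 'd) (snd \<omega>)"
  have pt: "(\<lambda>\<omega>. fst \<omega> i) \<in> borel_measurable ?K" if "i < n" for i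
  proof -
    have "(\<lambda>x. x i) \<in> (\<Pi>\<^sub>M i\<in>{..<n}. uniform_cube :: (real ^ 'd) measure) \<rightarrow>\<^sub>M uniform_cube"
      using that by (intro measurable_component_singleton) auto
    from measurable_compose[OF measurable_fst this] show ?thesis
      by (simp add: knn_space_def cong: measurable_cong_sets)
  qed
  have trial: "Measurable.pred ?K (\<lambda>\<omega>. snd \<omega> (i, j))" if "i < n" "j < n" for i j
  proof -
    have "(\<lambda>b. b (i, j)) \<in> (trials ({..<n} \<times> {..<n}) p)
            \<rightarrow>\<^sub>M measure_pmf (bernoulli_pmf p)"
      using that by (intro measurable_component_singleton) auto
    from measurable_compose[OF measurable_snd this] show ?thesis
      unfolding knn_space_def by (simp cong: measurable_cong_sets)
  qed
  have nn: "Measurable.pred ?K (\<lambda>\<omega>. j \<in> nearest_neighbors n k (fst \<omega>) i)" if ij: "i < n" "j < n" for i j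
  proof -
    have "{\<omega> \<in> space ?K. l \<in> {l. l < n \<and> l \<noteq> i \<and> dist (fst \<omega> i) (fst \<omega> l) < dist (fst \<omega> i) (fst \<omega> j)}}
        \<in> sets ?K" for l
    \<comment> \<open>The cardinality rule asks for every natural number \<open>l\<close>; outside
      the range of the sample and for \<open>l = i\<close> the event is empty.\<close>
    proof (cases "l < n \<and> l \<noteq> i")
      case True
      then have "l < n" by simp
      have "{\<omega> \<in> space ?K. dist (fst \<omega> i) (fst \<omega> l) < dist (fst \<omega> i) (fst \<omega> j)} \<in> sets ?K"
        by (intro borel_measurable_less borel_measurable_dist pt ij \<open>l < n\<close>)
      then show ?thesis
        using True by (simp only: mem_Collect_eq simp_thms)
    next
      case False
      then have "{\<omega> \<in> space ?K. l \<in> {l. l < n \<and> l \<noteq> i \<and>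
          dist (fst \<omega> i) (fst \<omega> l) < dist (fst \<omega> i) (fst \<omega> j)}} = {}"
        by blast
      then show ?thesis
        by (simp only: sets.empty_sets)
    qed
    from measurable_card[OF this]
    have "Measurable.pred ?K (\<lambda>\<omega>. card {l. l < n \<and> l \<noteq> i \<and>
        dist (fst \<omega> i) (fst \<omega> l) < dist (fst \<omega> i) (fst \<omega> j)} < k)"
      by (rule measurable_compose) (rule measurable_count_space)
    then show ?thesis
      unfolding nearest_neighbors_def mem_Collect_eq using ij
      by (cases "j = i") (simp_all only: simp_thms measurable_const UNIV_I space_count_space)
  qed
  have mem: "Measurable.pred ?K (\<lambda>\<omega>. e \<in> ?g \<omega>)" if e: "e \<in> {..<n} \<times> {..<n}" for e
  proof -
    obtain i j where "e = (i, j)" and ij: "i < n" "j < n"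
      using e by auto
    have "Measurable.pred ?K (\<lambda>\<omega>. (j \<in> nearest_neighbors n k (fst \<omega>) i \<and> snd \<omega> (i, j)) \<or>
        (i \<in> nearest_neighbors n k (fst \<omega>) j \<and> snd \<omega> (j, i)))"
      by (intro pred_intros_logic nn trial ij)
    then show ?thesis
      using ij by (simp only: knn_edges_def mem_Collect_eq prod.case simp_thms \<open>e = (i, j)\<close>)
  qed
  have sub: "?g \<omega> \<subseteq> {..<n} \<times> {..<n}" for \<omega>
    by (auto simp: knn_edges_def)
  have "?g -` {E} \<inter> space ?K \<in> sets ?K" if E: "E \<subseteq> {..<n} \<times> {..<n}" for E
  proof -
    have iff: "?g \<omega> = E \<longleftrightarrow> (\<forall>e\<in>{..<n} \<times> {..<n}. e \<in> ?g \<omega> \<longleftrightarrow> e \<in> E)" for \<omega>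
      using E sub[of \<omega>] by blast
    have "{\<omega> \<in> space ?K. \<forall>e\<in>{..<n} \<times> {..<n}. e \<in> ?g \<omega> \<longleftrightarrow> e \<in> E} \<in> sets ?K"
    proof (rule sets.sets_Collect_finite_All)
      fix e :: "nat \<times> nat" assume "e \<in> {..<n} \<times> {..<n}"
      then have "Measurable.pred ?K (\<lambda>\<omega>. e \<in> ?g \<omega> \<longleftrightarrow> e \<in> E)"
        by (intro pred_intros_logic mem measurable_const) (simp_all only: space_count_space UNIV_I)
      then show "{\<omega> \<in> space ?K. e \<in> ?g \<omega> \<longleftrightarrow> e \<in> E} \<in> sets ?K"
        by (simp only: pred_def)
    qed simp
    then show ?thesis
      by (simp only: iff[symmetric] vimage_def Int_def mem_Collect_eq singleton_iff conj_commute)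
  qed
  then have "?g \<in> ?K \<rightarrow>\<^sub>M count_space (Pow ({..<n} \<times> {..<n}))"
    using sub by (subst measurable_count_space_eq2) (blast intro: finite_SigmaI finite_lessThan)+
  then have "?g -` {E \<in> Pow ({..<n} \<times> {..<n}). R E} \<inter> space ?K \<in> sets ?K"
    by (rule measurable_sets) auto
  also have "?g -` {E \<in> Pow ({..<n} \<times> {..<n}). R E} \<inter> space ?K = {\<omega> \<in> space ?K. R (?g \<omega>)}"
    using sub by blast
  finally show ?thesis .
qed

text \<open>Fubini: for each typical sample the trials produce the giant component with probability
  at least \<open>1 - d2\<close>, and a sample is typical with probability at least
  \<open>1 - d1\<close>.\<close>

lemma knn_giant_component_prob:
  fixes lo hi :: real
  assumes m: "m > 0" and p: "0 \<le> p" "p \<le> 1" and s: "3 * real s \<le> lo" and k: "hi \<le> real k"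
    and r: "real m ^ CARD('d) * real s \<le> (r :: real)"
    and d1: "real m ^ CARD('d) * (exp (lo - n / real m ^ CARD('d) / 2) +
             exp (2 * real n * ((4 * real CARD('d) + 2) ^ CARD('d) / real m ^ CARD('d)) - hi)) \<le> d1"
    and d2: "real m ^ CARD('d) * exp (2 * hi - p * (real s)\<^sup>2) \<le> d2" "d2 \<le> 1"
  shows "\<P>((x, b) in (knn_space n p :: ((nat \<Rightarrow> real ^ 'd) \<times> (nat \<times> nat \<Rightarrow> bool)) measure).
            \<exists>C \<in> connected_components {..<n} (knn_edges n k x b). real (card C) \<ge> real n - r)
          \<ge> (1 - d1) * (1 - d2)"
proof -
  let ?P = "\<Pi>\<^sub>M i\<in>{..<n}. uniform_cube :: (real ^ 'd) measure"
  let ?B = "trials ({..<n} \<times> {..<n}) p"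
  let ?R = "\<lambda>E. \<exists>C \<in> connected_components {..<n} E. real (card C) \<ge> real n - r"
  let ?G = "typical_pts n m lo hi :: (nat \<Rightarrow> real ^ 'd) set"
  interpret P: prob_space ?P
    by (intro prob_space_PiM prob_space_uniform_cube)
  interpret B: prob_space ?B
    by (intro prob_space_PiM measure_pmf.prob_space_axioms)
  interpret PB: pair_prob_space ?P ?B ..
  define S where "S = {\<omega> \<in> space (?P \<Otimes>\<^sub>M ?B). ?R (knn_edges n k (fst \<omega>) (snd \<omega>))}"
  have S: "S \<in> sets (?P \<Otimes>\<^sub>M ?B)"
    using knn_edges_event[where n = n and p = p and k = k and R = ?R] by (simp add: S_def knn_space_def)
  have typical: "1 - d2 \<le> B.prob (Pair x -` S)" if x: "x \<in> ?G" for x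
  proof -
    let ?bad = "\<lambda>z. {b \<in> space ?B. unjoined s (pts n x (block m z)) b}"
    have bad: "?bad z \<in> B.events" "B.prob (?bad z) \<le> exp (2 * hi - p * (real s)\<^sup>2)" if "z \<in> grid m" for z
      using that x by (intro prob_unjoined p; auto simp: pts_def typical_pts_def less_imp_le)+
    have "B.prob (\<Union>z\<in>grid m. ?bad z) \<le> (\<Sum>z\<in>grid m. B.prob (?bad z))"
      using finite_grid bad(1) by (intro measure_UNION_le) auto
    also have "\<dots> \<le> (\<Sum>z\<in>(grid m :: ('d \<Rightarrow> nat) set). exp (2 * hi - p * (real s)\<^sup>2))"
      by (intro sum_mono bad)
    finally have le: "B.prob (\<Union>z\<in>grid m. ?bad z) \<le> d2"
      using d2(1) by (simp add: card_grid)
    \<comment> \<open>Once no block is unjoined, the deterministic criterion applies to the fixed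
      typical sample \<open>x\<close>.\<close>
    have "space ?B - (\<Union>z\<in>grid m. ?bad z) \<subseteq> Pair x -` S"
    proof
      fix b assume b: "b \<in> space ?B - (\<Union>z\<in>grid m. ?bad z)"
      have "\<exists>C\<in>connected_components {..<n} (knn_edges n k x b). n \<le> card C + m ^ CARD('d) * s"
      proof (rule knn_giant_component[OF m])
        show "x i \<in> cbox 0 1" if "i < n" for i
          using x that by (auto simp: typical_pts_def)
        fix z :: "'d \<Rightarrow> nat" assume z: "z \<in> grid m"
        then have "lo < real (card (pts n x (cell m z)))" "real (card (pts n x (block m z))) < hi"
          using x by (auto simp: typical_pts_def)
        then show "3 * s \<le> card (pts n x (cell m z))" "card (pts n x (block m z)) < k"
          using s k by linarith+
        fix A A' assume "A \<subseteq> pts n x (block m z)" "A' \<subseteq> pts n x (block m z)" "A \<inter> A' = {}"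
          "s \<le> card A" "s \<le> card A'"
        moreover have "\<not> unjoined s (pts n x (block m z)) b"
          using b z by auto
        ultimately show "\<exists>a\<in>A. \<exists>a'\<in>A'. b (a, a')"
          unfolding unjoined_def by blast
      qed
      then obtain C where C: "C \<in> connected_components {..<n} (knn_edges n k x b)"
        and card: "n \<le> card C + m ^ CARD('d) * s"
        by blast
      have "real n \<le> real (card C) + m ^ CARD('d) * s"
        using card by (simp only: of_nat_le_iff flip: of_nat_add of_nat_mult of_nat_power)
      then have "?R (knn_edges n k x b)"
        using C r by (intro bexI[of _ C]) auto
      then show "b \<in> Pair x -` S"
        using x b by (auto simp: S_def space_pair_measure typical_pts_def)
    qed
    then have "B.prob (space ?B - (\<Union>z\<in>grid m. ?bad z)) \<le> B.prob (Pair x -` S)"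
      using S by (intro B.finite_measure_mono sets_Pair1)
    moreover have "B.prob (space ?B - (\<Union>z\<in>grid m. ?bad z)) = 1 - B.prob (\<Union>z\<in>grid m. ?bad z)"
      using bad(1) finite_grid by (intro B.prob_compl sets.finite_UN) auto
    ultimately show ?thesis
      using le by simp
  qed
  \<comment> \<open>The measure of \<open>S\<close> is the integral of its sections; those over
    atypical samples are bounded below by 0.\<close>
  have "ennreal (1 - d2) * emeasure ?P ?G = (\<integral>\<^sup>+x. ennreal (1 - d2) * indicator ?G x \<partial>?P)"
    using typical_pts_prob(1)[OF m] by (subst nn_integral_cmult_indicator) auto
  also have "\<dots> \<le> (\<integral>\<^sup>+x. emeasure ?B (Pair x -` S) \<partial>?P)"
    using typical by (intro nn_integral_mono)
      (auto simp: indicator_def B.emeasure_eq_measure intro!: ennreal_leI)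
  also have "\<dots> = emeasure (?P \<Otimes>\<^sub>M ?B) S"
    using S by (rule B.emeasure_pair_measure_alt[symmetric])
  finally have "(1 - d2) * P.prob ?G \<le> measure (?P \<Otimes>\<^sub>M ?B) S"
    using d2 by (simp add: P.emeasure_eq_measure PB.emeasure_eq_measure flip: ennreal_mult)
  moreover have "(1 - d1) * (1 - d2) \<le> P.prob ?G * (1 - d2)"
    using d2 d1 typical_pts_prob(2)[OF m, where 'd = 'd and n = n and lo = lo and hi = hi]
    by (intro mult_right_mono) auto
  ultimately have "(1 - d1) * (1 - d2) \<le> measure (?P \<Otimes>\<^sub>M ?B) S"
    by (simp add: mult.commute)
  then show ?thesis
    by (simp add: S_def knn_space_def split_def)
qed

section \<open>Choice of the parameters\<close>

text \<open>
  The expected number of points in a block is at most \<open>8 \<sqdot> 2\<^sup>d (4 d + 2)\<^sup>d L\<close>; \<open>b L\<close> exceeds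
  twice this by \<open>3 L\<close>, which leaves a Chernoff bound of \<open>n\<^bsup>-3\<^esup>\<close> per block.
\<close>
lemma knn_giant_component_logarithmic:
  fixes n :: nat and L b :: real
  defines "L \<equiv> ln (real n)"
    and "b \<equiv> 16 * 2 ^ CARD('d) * (4 * real CARD('d) + 2) ^ CARD('d) + 3"
  assumes L: "1 \<le> L" "8 * L \<le> n" and LL: "1 \<le> ln L" "2 * b + 2 \<le> sqrt (ln L)" "ln L \<le> L"
    and s: "3 * (L / ln L powr (1/4) + 1) \<le> L"
  shows "\<P>((x, t) in (knn_space n (edge_prob 1 n) :: ((nat \<Rightarrow> real ^ 'd) \<times> (nat \<times> nat \<Rightarrow> bool)) measure).
            \<exists>C \<in> connected_components {..<n} (knn_edges n (num_neighbors (b + 1) n) x t).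
              real (card C) \<ge> real n - n / (8 * L) * (L / ln L powr (1/4) + 1))
          \<ge> (1 - 2 * exp (- 2 * L)) * (1 - exp (- L))"
proof -
  let ?d = "CARD('d)"
  \<comment> \<open>The largest \<open>m\<close> with \<open>m ^ d \<le> n / (8 * L)\<close>, so
    that a cell expects at least \<open>8 * L\<close> points.\<close>
  define m where "m = nat \<lfloor>root ?d (n / (8 * L))\<rfloor>"
  define M where "M = real m ^ ?d"
  define u where "u = L / ln L powr (1/4)"
  define s' where "s' = nat \<lfloor>u\<rfloor> + 1"
  have d: "?d > 0" by simp
  have n: "n > 0" "exp L = n"
    using L by (auto simp: L_def intro!: exp_ln Nat.gr0I)
  have "1 \<le> n / (8 * L)"
    using L by simp
  then have "1 \<le> root ?d (n / (8 * L))"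
    using d by simp
  then have m: "m > 0" "real m \<le> root ?d (n / (8 * L))" "root ?d (n / (8 * L)) < real m + 1"
    unfolding m_def by linarith+
  have M0: "M > 0"
    using m by (simp add: M_def)
  have "M \<le> root ?d (n / (8 * L)) ^ ?d"
    unfolding M_def using m by (intro power_mono) auto
  then have M1: "M \<le> n / (8 * L)"
    using d L by (simp add: real_root_pow_pos2)
  \<comment> \<open>As \<open>m \<ge> 1\<close>, the root is below \<open>m + 1 \<le> 2 * m\<close>:
    rounding costs at most a factor \<open>2 ^ d\<close>.\<close>
  have "root ?d (n / (8 * L)) ^ ?d \<le> (2 * real m) ^ ?d"
    using m L by (intro power_mono) auto
  then have M2: "n / (8 * L) \<le> 2 ^ ?d * M"
    using d L by (simp add: real_root_pow_pos2 M_def power_mult_distrib)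
  have "n / (8 * L) \<le> n"
    using L by (simp add: field_simps)
  then have M3: "M \<le> exp L"
    using M1 n by simp
  have nM: "8 * L \<le> n / M" "n / M \<le> 8 * 2 ^ ?d * L"
    using M0 M1 M2 L by (simp_all add: field_simps)
  have s': "u \<le> s'" "real s' \<le> u + 1"
    using L by (auto simp: s'_def u_def) linarith
  have p: "0 \<le> edge_prob 1 n" "edge_prob 1 n \<le> 1"
    using L LL by (simp_all add: edge_prob_def L_def)
  \<comment> \<open>The edge probability is \<open>ln L / L\<close> and
    \<open>u\<^sup>2 = L\<^sup>2 / sqrt (ln L)\<close>. The exponent 1/4 thus leaves a factor
    \<open>sqrt (ln L)\<close>, which outgrows every constant.\<close>
  have ps: "L * sqrt (ln L) \<le> edge_prob 1 n * (real s')\<^sup>2"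
  proof -
    have "(ln L powr (1/4))\<^sup>2 = sqrt (ln L)"
      using LL by (simp add: power2_eq_square powr_half_sqrt flip: powr_add)
    then have "ln L / L * u\<^sup>2 = L * (ln L / sqrt (ln L))"
      by (simp add: u_def power_divide power2_eq_square)
    then have "L * sqrt (ln L) = ln L / L * u\<^sup>2"
      using LL by (simp add: real_div_sqrt)
    also have "\<dots> \<le> ln L / L * (real s')\<^sup>2"
      using s' L LL by (intro mult_left_mono power_mono) (auto simp: u_def)
    finally show ?thesis
      by (simp add: edge_prob_def L_def)
  qed
  have "b \<ge> 0"
    by (simp add: b_def)
  show ?thesis
  proof (rule knn_giant_component_prob[where m = m and s = s' and lo = L and hi = "b * L"])
    show "3 * real s' \<le> L"
      using s s' by (simp add: u_def)
    \<comment> \<open>Taking \<open>b + 1\<close> instead of \<open>b\<close> absorbs the rounding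
      of the number of neighbors, since \<open>L \<ge> 1\<close>.\<close>
    have "(b + 1) * L - 1 \<le> real (num_neighbors (b + 1) n)"
      unfolding num_neighbors_def L_def by linarith
    then show "b * L \<le> real (num_neighbors (b + 1) n)"
      using L by (simp add: distrib_right)
    show "real m ^ ?d * real s' \<le> n / (8 * L) * (L / ln L powr (1/4) + 1)"
      using M1 M0 s' L unfolding u_def M_def by (intro mult_mono) auto
    have e1: "L - n / M / 2 \<le> - (3 * L)"
      using nM by simp
    have "2 * real n * ((4 * real ?d + 2) ^ ?d / M) = 2 * (4 * real ?d + 2) ^ ?d * (n / M)"
      by simp
    also have "\<dots> \<le> 2 * (4 * real ?d + 2) ^ ?d * (8 * 2 ^ ?d * L)"
      using nM by (intro mult_left_mono) auto
    also have "\<dots> = b * L - 3 * L"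
      by (simp add: b_def algebra_simps)
    finally have e2: "2 * real n * ((4 * real ?d + 2) ^ ?d / M) - b * L \<le> - (3 * L)"
      by simp
    have "M * (exp (L - n / M / 2) + exp (2 * real n * ((4 * real ?d + 2) ^ ?d / M) - b * L))
            \<le> exp L * (exp (- (3 * L)) + exp (- (3 * L)))"
      using M0 M3 e1 e2 by (intro mult_mono add_mono) auto
    also have "\<dots> = 2 * exp (- 2 * L)"
      by (simp add: mult_exp_exp)
    finally show "real m ^ ?d * (exp (L - n / real m ^ ?d / 2) +
        exp (2 * real n * ((4 * real ?d + 2) ^ ?d / real m ^ ?d) - b * L)) \<le> 2 * exp (- 2 * L)"
      by (simp only: M_def)
    \<comment> \<open>The part \<open>2 * b\<close> pays for the choices of \<open>(A, B)\<close>.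
      The remaining 2 gives \<open>exp (- 2 * L)\<close> per block, and there are at most
      \<open>exp L\<close> blocks.\<close>
    have "L * (2 * b + 2) \<le> L * sqrt (ln L)"
      using L LL by (intro mult_left_mono) auto
    then have "2 * (b * L) - edge_prob 1 n * (real s')\<^sup>2 \<le> - (2 * L)"
      using ps by (simp add: algebra_simps)
    then have "M * exp (2 * (b * L) - edge_prob 1 n * (real s')\<^sup>2) \<le> exp L * exp (- (2 * L))"
      using M0 M3 by (intro mult_mono) auto
    also have "\<dots> = exp (- L)"
      by (simp add: mult_exp_exp)
    finally show "real m ^ ?d * exp (2 * (b * L) - edge_prob 1 n * (real s')\<^sup>2) \<le> exp (- L)"
      by (simp only: M_def)
  qed (use m p L in auto)
qed

theorem theorem2:
  shows "\<exists>c1 > 0. \<exists>c2 > 0. \<exists>r :: nat \<Rightarrow> real. r \<in> o(\<lambda>n. real n) \<and>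
    (\<lambda>n. \<P>((x, b) in (knn_space n (edge_prob c2 n)
              :: ((nat \<Rightarrow> real ^ 'd) \<times> (nat \<times> nat \<Rightarrow> bool)) measure).
            \<exists>C \<in> connected_components {..<n} (knn_edges n (num_neighbors c1 n) x b).
              real (card C) \<ge> real n - r n)) \<longlonglongrightarrow> 1"
proof -
  define c where "c = 16 * 2 ^ CARD('d) * (4 * real CARD('d) + 2) ^ CARD('d) + 3"
  \<comment> \<open>A bound for the number of cells times the loss per cell. It equals
    \<open>n / (8 * ln (ln n) powr (1/4)) + n / (8 * ln n)\<close> for large \<open>n\<close>, hence
    is \<open>o(n)\<close>.\<close>
  define r where "r n = n / (8 * ln (real n)) * (ln (real n) / ln (ln (real n)) powr (1/4) + 1)"
    for n :: nat
  let ?prob = "\<lambda>n. \<P>((x, b) in (knn_space n (edge_prob 1 n)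
              :: ((nat \<Rightarrow> real ^ 'd) \<times> (nat \<times> nat \<Rightarrow> bool)) measure).
            \<exists>C \<in> connected_components {..<n} (knn_edges n (num_neighbors (c + 1) n) x b).
              real (card C) \<ge> real n - r n)"
  have "filterlim (\<lambda>n. sqrt (ln (ln (real n)))) at_top sequentially"
    by real_asymp
  then have large: "\<forall>\<^sub>F n in sequentially. 2 * c + 2 \<le> sqrt (ln (ln (real n)))"
    by (simp add: filterlim_at_top)
  have "\<forall>\<^sub>F n :: nat in sequentially. 1 \<le> ln (real n)"
    "\<forall>\<^sub>F n :: nat in sequentially. 8 * ln (real n) \<le> n"
    "\<forall>\<^sub>F n :: nat in sequentially. 1 \<le> ln (ln (real n))"
    "\<forall>\<^sub>F n :: nat in sequentially. ln (ln (real n)) \<le> ln (real n)"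
    "\<forall>\<^sub>F n :: nat in sequentially.
       3 * (ln (real n) / ln (ln (real n)) powr (1/4) + 1) \<le> ln (real n)"
    by real_asymp+
  with large have lower: "\<forall>\<^sub>F n in sequentially.
      (1 - 2 * exp (- 2 * ln (real n))) * (1 - exp (- ln (real n))) \<le> ?prob n"
  proof eventually_elim
    case (elim n)
    then show ?case
      unfolding c_def r_def by (intro knn_giant_component_logarithmic)
  qed
  have "prob_space (knn_space n p :: ((nat \<Rightarrow> real ^ 'd) \<times> _) measure)" for n p
    unfolding knn_space_def
    by (intro prob_space_pair prob_space_PiM prob_space_uniform_cube
        measure_pmf.prob_space_axioms)
  then have upper: "\<forall>\<^sub>F n in sequentially. ?prob n \<le> 1"
    by (intro always_eventually allI prob_space.prob_le_1)
  \<comment> \<open>For positive \<open>n\<close> this lower bound is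
    \<open>(1 - 2 / n\<^sup>2) * (1 - 1 / n)\<close>.\<close>
  have "(\<lambda>n. (1 - 2 * exp (- 2 * ln (real n))) * (1 - exp (- ln (real n)))) \<longlonglongrightarrow> 1"
    by real_asymp
  then have "?prob \<longlonglongrightarrow> 1"
    by (rule tendsto_sandwich[OF lower upper _ tendsto_const])
  moreover have "r \<in> o(\<lambda>n. real n)"
    unfolding r_def by real_asymp
  moreover have "c + 1 > 0"
    by (simp add: c_def add_nonneg_pos)
  ultimately show ?thesis
    by (intro exI[of _ "c + 1"] exI[of _ 1] exI[of _ r] conjI zero_less_one)
qed

end
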